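(* Let $k$ be an algebraically closed field of characteristic $0$ and let $\kappa$ be its cardinality. There exist $2^{\kappa}$ elements of $\Sigma_\kappa\cap\check\Sigma_\kappa$ that are maximal with respect to $\le_p$.
   Context: For $A,B\subseteq k$, $A\le_p B$ means that there is a polynomial $P\in k[X]$ with $A=P^{-1}(B)$; $A\equiv_p B$ means $A\le_p B$ and $B\le_p A$; $[A]$ is the $\equiv_p$-class of $A$; $[A]\le_p[B]$ iff $A\le_p B$, which is a partial order on the set of classes of subsets of $k$. If $A\equiv_p B$ then $A$ and $B$ have the same cardinality, and so do their complements. $\Sigma_\kappa\cap\check\Sigma_\kappa$ is the set of classes $[A]$ of sets $A\subseteq k$ such that both $A$ and $k\setminus A$ have cardinality $\kappa$. *)

theory Defs
  imports Complex_Main "HOL-Computational_Algebra.Polynomial"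
begin

unbundle cardinal_syntax

definition poly_reducible :: "'a::field set \<Rightarrow> 'a set \<Rightarrow> bool" (infix \<open>\<le>\<^sub>p\<close> 50)
  where "A \<le>\<^sub>p B \<longleftrightarrow> (\<exists>P :: 'a poly. A = poly P -` B)"

definition poly_equivalent :: "'a::field set \<Rightarrow> 'a set \<Rightarrow> bool" (infix \<open>\<equiv>\<^sub>p\<close> 50)
  where "A \<equiv>\<^sub>p B \<longleftrightarrow> A \<le>\<^sub>p B \<and> B \<le>\<^sub>p A"

lemma poly_reducible_refl: "A \<le>\<^sub>p A"
  unfolding poly_reducible_def by (rule exI [of _ "[:0, 1:]"]) auto

lemma poly_reducible_trans:
  assumes "A \<le>\<^sub>p B" and "B \<le>\<^sub>p C"
  shows "A \<le>\<^sub>p C"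
proof -
  from assms obtain P Q where "A = poly P -` B" and "B = poly Q -` C"
    unfolding poly_reducible_def by blast
  then have "A = poly (pcompose Q P) -` C"
    by (auto simp: poly_pcompose)
  then show ?thesis
    unfolding poly_reducible_def by blast
qed

lemma equivp_poly_equivalent: "equivp (poly_equivalent :: 'a::field set \<Rightarrow> 'a set \<Rightarrow> bool)"
  by (rule equivpI)
    (auto simp: reflp_def symp_def transp_def poly_equivalent_def
      intro: poly_reducible_refl poly_reducible_trans)

quotient_type (overloaded) 'a poly_degree = "'a::field set" / poly_equivalent
  morphisms rep_poly_degree poly_degree_of
  by (rule equivp_poly_equivalent)

instantiation poly_degree :: (field) order
begin

lift_definition less_eq_poly_degree :: "'a poly_degree \<Rightarrow> 'a poly_degree \<Rightarrow> bool"
  is poly_reducible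
  unfolding poly_equivalent_def by (blast intro: poly_reducible_trans)

definition less_poly_degree :: "'a poly_degree \<Rightarrow> 'a poly_degree \<Rightarrow> bool"
  where "less_poly_degree c d \<longleftrightarrow> c \<le> d \<and> \<not> d \<le> c"

instance
proof
  fix a b c :: "'a poly_degree"
  show "a < b \<longleftrightarrow> a \<le> b \<and> \<not> b \<le> a"
    by (fact less_poly_degree_def)
  show "a \<le> a"
    by transfer (rule poly_reducible_refl)
  show "a \<le> c" if "a \<le> b" and "b \<le> c"
    using that by transfer (rule poly_reducible_trans)
  show "a = b" if "a \<le> b" and "b \<le> a"
    using that by transfer (simp add: poly_equivalent_def)
qed

end

text \<open>
  \<open>\<kappa>\<close> is a cardinal in the sense of the library, i.e. a well-order of minimal length, such as
  \<open>|UNIV|\<close>. Over an algebraically closed field, the condition on \<open>A\<close> does not depend on the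
  representative of its class.
\<close>

definition Sigma_inter_dual :: "'b rel \<Rightarrow> 'a::field poly_degree set"
  where "Sigma_inter_dual \<kappa> = {poly_degree_of A | A. |A| =o \<kappa> \<and> |- A| =o \<kappa>}"

text \<open>Maximality is in the poset of all classes of subsets of the field.\<close>

definition maximal_degree :: "'a::field poly_degree \<Rightarrow> bool"
  where "maximal_degree c \<longleftrightarrow> (\<nexists>d. c < d)"

end

theory Submission
  imports Defs
begin

text \<open>
  If \<open>A = P\<^sup>-\<^sup>1(B)\<close>, then \<open>A\<close> is a union of fibres of \<open>P\<close>. When \<open>P\<close> has degree 1 it is a
  bijection with polynomial inverse, so \<open>B \<equiv>\<^sub>p A\<close>. Hence \<open>A\<close> has maximal degree as soon as it
  splits some fibre of every polynomial of degree at least 2, that is, contains one point of that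
  fibre and misses another (\<open>maximal_degreeI\<close>).

  Such sets are built by diagonalisation. There are only \<open>\<kappa>\<close> polynomials
  (\<open>card_of_poly_ordLeq\<close>), so they can be listed as \<open>P\<^sub>a\<close> with \<open>a\<close> in \<open>k\<close>. In characteristic 0 a
  polynomial of degree at least 2 has only finitely many fibres with fewer than two points, so fewer
  than \<open>\<kappa>\<close> forbidden points never exhaust its fibres (\<open>fibre_pair_avoiding\<close>). Going through the
  indices in a well-order of length \<open>\<kappa>\<close>, one can therefore choose two points
  \<open>x\<^sub>a\<close>, \<open>y\<^sub>a\<close> with \<open>P\<^sub>a(x\<^sub>a) = P\<^sub>a(y\<^sub>a)\<close>, all chosen points being distinct
  (\<open>disjoint_pair_transversal\<close>).

  Each pair can be split in two ways: every \<open>S \<subseteq> k\<close> gives the set containing \<open>x\<^sub>a\<close> for \<open>a \<in> S\<close> and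
  \<open>y\<^sub>a\<close> for \<open>a \<notin> S\<close>. These \<open>2\<^sup>\<kappa>\<close> sets are distinct, they and their complements have cardinality
  \<open>\<kappa>\<close>, and each has maximal degree. Finally, a class has at most \<open>\<kappa>\<close> members, one for each
  reducing polynomial, so \<open>2\<^sup>\<kappa>\<close> sets lie in \<open>2\<^sup>\<kappa>\<close> classes (\<open>card_of_degrees_ordLeq\<close>).
\<close>

section \<open>Choosing disjoint pairs\<close>

text \<open>
  The indices are well-ordered in the length of the cardinal of their type, so fewer than that many
  points are in use at each stage, and the hypothesis leaves room for the next pair.
\<close>

lemma disjoint_pair_transversal:
  fixes R :: "'i \<Rightarrow> ('a \<times> 'a) set"
  assumes inf: "infinite (UNIV :: 'i set)"
    and avoid: "\<And>i X. |X| <o |UNIV :: 'i set| \<Longrightarrow>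
      \<exists>x y. (x, y) \<in> R i \<and> x \<noteq> y \<and> x \<notin> X \<and> y \<notin> X"
  shows "\<exists>x y. (\<forall>i. (x i, y i) \<in> R i) \<and> inj x \<and> inj y \<and> range x \<inter> range y = {}"
proof -
  let ?r = "|UNIV :: 'i set|"
  have wo: "Well_order ?r" and field: "Field ?r = UNIV"
    by (rule card_of_Well_order) (rule Field_card_of)
  have wf: "wf (?r - Id)"
    using wo by (simp add: well_order_on_def)
  define used :: "('i \<Rightarrow> 'a \<times> 'a) \<Rightarrow> 'i \<Rightarrow> 'a set"
    where "used f i = fst ` f ` underS ?r i \<union> snd ` f ` underS ?r i" for f i
  have used_cong: "used f i = used g i"
    if "\<And>j. (j, i) \<in> ?r - Id \<Longrightarrow> f j = g j" for f g i
  proof -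
    have "f ` underS ?r i = g ` underS ?r i"
      using that by (intro image_cong) (auto simp: underS_def)
    then show ?thesis by (simp add: used_def)
  qed
  have used_less: "|used f i| <o ?r" for f i
  proof -
    have "|underS ?r i| <o ?r"
      by (rule card_of_underS[OF card_of_Card_order]) (simp add: field)
    then have "|h ` f ` underS ?r i| <o ?r" for h :: "'a \<times> 'a \<Rightarrow> 'a"
      by (metis card_of_image ordLeq_ordLess_trans)
    then show ?thesis
      unfolding used_def by (intro card_of_Un_ordLess_infinite inf)
  qed
  have "\<exists>f. \<forall>i. f i \<in> R i \<and> fst (f i) \<noteq> snd (f i) \<and> fst (f i) \<notin> used f i \<and> snd (f i) \<notin> used f i"
  proof (rule dependent_wf_choice[OF wf, where
        P = "\<lambda>f i p. p \<in> R i \<and> fst p \<noteq> snd p \<and> fst p \<notin> used f i \<and> snd p \<notin> used f i"])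
    fix f g :: "'i \<Rightarrow> 'a \<times> 'a" and i p
    assume "\<And>j. (j, i) \<in> ?r - Id \<Longrightarrow> f j = g j"
    then have "used f i = used g i" by (rule used_cong)
    then show "(p \<in> R i \<and> fst p \<noteq> snd p \<and> fst p \<notin> used f i \<and> snd p \<notin> used f i) =
        (p \<in> R i \<and> fst p \<noteq> snd p \<and> fst p \<notin> used g i \<and> snd p \<notin> used g i)"
      by simp
  next
    fix i and f :: "'i \<Rightarrow> 'a \<times> 'a"
    show "\<exists>p. p \<in> R i \<and> fst p \<noteq> snd p \<and> fst p \<notin> used f i \<and> snd p \<notin> used f i"
      using avoid[OF used_less[of f i], of i] by force
  qed
  then obtain f where f: "\<And>i. f i \<in> R i" "\<And>i. fst (f i) \<noteq> snd (f i)"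
    "\<And>i. fst (f i) \<notin> used f i" "\<And>i. snd (f i) \<notin> used f i"
    by blast
  have apart: "{fst (f i), snd (f i)} \<inter> {fst (f j), snd (f j)} = {}" if "i \<noteq> j" for i j
  proof -
    have earlier: "{fst (f i), snd (f i)} \<inter> {fst (f j), snd (f j)} = {}" if "i \<in> underS ?r j" for i j
      using f(3,4)[of j] that unfolding used_def by auto
    have "total_on (Field ?r) ?r"
      using wo by (auto simp: well_order_on_def linear_order_on_def)
    with \<open>i \<noteq> j\<close> have "(i, j) \<in> ?r \<or> (j, i) \<in> ?r"
      by (simp add: total_on_def field)
    with \<open>i \<noteq> j\<close> have "i \<in> underS ?r j \<or> j \<in> underS ?r i"
      by (auto simp: underS_def)
    then show ?thesis
      using earlier by blast
  qed
  show ?thesis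
  proof (intro exI conjI allI)
    show "((fst \<circ> f) i, (snd \<circ> f) i) \<in> R i" for i
      using f(1) by simp
    show "inj (fst \<circ> f)" "inj (snd \<circ> f)"
      by (rule injI, rule ccontr, drule apart, simp)+
    show "range (fst \<circ> f) \<inter> range (snd \<circ> f) = {}"
    proof -
      have "fst (f i) \<noteq> snd (f j)" for i j
        using f(2)[of i] apart[of i j] by (cases "i = j") auto
      then show ?thesis by auto
    qed
  qed
qed

section \<open>Polynomials over an infinite field\<close>

lemma card_of_poly_ordLeq:
  assumes inf: "infinite (UNIV :: 'a::zero set)"
  shows "|UNIV :: 'a poly set| \<le>o |UNIV :: 'a set|"
proof -
  have bounded: "|{p :: 'a poly. degree p \<le> n}| \<le>o |UNIV :: 'a set|" for n
  proof (induction n)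
    case 0
    have "{p :: 'a poly. degree p \<le> 0} \<subseteq> range (\<lambda>a. [:a:])"
      by (auto elim: degree_eq_zeroE)
    then show ?case by (rule surj_imp_ordLeq)
  next
    case (Suc n)
    have "{p :: 'a poly. degree p \<le> Suc n} \<subseteq>
        (\<lambda>(a, q). pCons a q) ` (UNIV \<times> {q. degree q \<le> n})"
    proof
      fix p :: "'a poly"
      assume "p \<in> {p. degree p \<le> Suc n}"
      then show "p \<in> (\<lambda>(a, q). pCons a q) ` (UNIV \<times> {q. degree q \<le> n})"
        by (cases p) (auto split: if_splits)
    qed
    then have "|{p :: 'a poly. degree p \<le> Suc n}| \<le>o |(UNIV :: 'a set) \<times> {q :: 'a poly. degree q \<le> n}|"
      by (rule surj_imp_ordLeq)
    also have "|(UNIV :: 'a set) \<times> {q :: 'a poly. degree q \<le> n}| \<le>o |(UNIV :: 'a set) \<times> (UNIV :: 'a set)|"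
      by (rule card_of_Times_mono2[OF Suc.IH])
    also have "|(UNIV :: 'a set) \<times> (UNIV :: 'a set)| =o |UNIV :: 'a set|"
      by (rule card_of_Times_same_infinite[OF inf])
    finally show ?case .
  qed
  have "|\<Union>n\<in>(UNIV :: nat set). {p :: 'a poly. degree p \<le> n}| \<le>o |UNIV :: 'a set|"
    using inf bounded by (intro card_of_UNION_ordLeq_infinite) (auto simp: infinite_iff_card_of_nat)
  moreover have "(\<Union>n\<in>(UNIV :: nat set). {p :: 'a poly. degree p \<le> n}) = UNIV"
    by auto
  ultimately show ?thesis by simp
qed

text \<open>
  A fibre through no critical point has no multiple points, so by algebraic closedness it has as many
  points as the degree. Both the critical points and the points of \<open>X\<close> are excluded by discarding
  the fibres through them, whose union is still smaller than the field because fibres are finite.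
\<close>

lemma fibre_pair_avoiding:
  fixes p :: "'k::{alg_closed_field, field_char_0} poly"
  assumes deg: "degree p \<ge> 2" and X: "|X| <o |UNIV :: 'k set|"
  shows "\<exists>x y. poly p x = poly p y \<and> x \<noteq> y \<and> x \<notin> X \<and> y \<notin> X"
proof -
  have inf: "infinite (UNIV :: 'k set)"
    by (rule infinite_UNIV_char_0)
  have finite_less: "|S| <o |T|" if "finite S" "infinite T" for S T :: "'k set"
    by (rule finite_ordLess_infinite[OF card_of_Well_order card_of_Well_order])
      (simp_all add: that Field_card_of)
  have finite_fibre: "finite {z. poly p z = c}" for c
  proof -
    have "p - [:c:] \<noteq> 0"
      using deg by auto
    from poly_roots_finite[OF this] show ?thesis by simp
  qed
  define W where "W = X \<union> {z. poly (pderiv p) z = 0}"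
  define Z where "Z = (\<Union>w\<in>W. {z. poly p z = poly p w})"
  have "finite {z. poly (pderiv p) z = 0}"
    using deg by (intro poly_roots_finite) (auto simp: pderiv_eq_0_iff)
  then have W: "|W| <o |UNIV :: 'k set|"
    unfolding W_def by (intro card_of_Un_ordLess_infinite[OF inf X] finite_less inf)
  have "Z \<noteq> UNIV"
  proof (cases "finite W")
    case True
    then have "finite Z"
      unfolding Z_def using finite_fibre by blast
    then show ?thesis using inf by auto
  next
    case False
    have "|Z| \<le>o |W|"
      unfolding Z_def using False finite_fibre
      by (intro card_of_UNION_ordLeq_infinite)
        (auto intro: ordLess_imp_ordLeq finite_less ordLeq_reflexive card_of_Well_order)
    then have "|Z| <o |UNIV :: 'k set|"
      using W by (rule ordLeq_ordLess_trans)
    then show ?thesis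
      using ordLess_irreflexive by auto
  qed
  then obtain x where "x \<notin> Z" by auto
  then have away: "z \<notin> W" if "poly p z = poly p x" for z
    using that by (auto simp: Z_def)
  have "poly (p - [:poly p x:]) x = 0"
    by simp
  then obtain s where s: "p - [:poly p x:] = [:- x, 1:] * s"
    unfolding poly_eq_0_iff_dvd by (rule dvdE)
  have "degree (p + - [:poly p x:]) = degree p"
    using deg by (intro degree_add_eq_left) simp
  then have "degree ([:- x, 1:] * s) = degree p"
    unfolding s[symmetric] by (simp only: add_uminus_conv_diff)
  then have "degree s > 0"
    using deg by (cases "s = 0") (auto simp: degree_mult_eq simp del: mult_pCons_left)
  then obtain y where y: "poly s y = 0"
    using alg_closed_imp_poly_has_root by blast
  have "poly (p - [:poly p x:]) y = 0"
    unfolding s using y by simp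
  then have fibre: "poly p y = poly p x"
    by simp
  (* Otherwise x is a multiple root of p - p(x), hence a critical point. *)
  have "x \<noteq> y"
  proof
    assume "x = y"
    have "pderiv p = pderiv (p - [:poly p x:])"
      by (simp add: pderiv_diff)
    also have "\<dots> = [:- x, 1:] * pderiv s + s * pderiv [:- x, 1:]"
      unfolding s by (rule pderiv_mult)
    finally have "poly (pderiv p) x = 0"
      using y \<open>x = y\<close> by (simp add: pderiv_pCons)
    then show False
      using away[of x] by (simp add: W_def)
  qed
  with fibre away[of x] away[of y] show ?thesis
    unfolding W_def by force
qed

section \<open>Degrees\<close>

text \<open>
  A set that splits fibres is not the preimage of anything under a polynomial of degree at least 2.
  It is proper and nonempty, which excludes constants; a linear reduction can be inverted.
\<close>

lemma maximal_degreeI: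
  fixes A :: "'k::field set"
  assumes split: "\<And>P :: 'k poly. degree P \<ge> 2 \<Longrightarrow> \<exists>x\<in>A. \<exists>y\<in>- A. poly P x = poly P y"
  shows "maximal_degree (poly_degree_of A)"
proof -
  have "B \<le>\<^sub>p A" if "A \<le>\<^sub>p B" for B
  proof -
    from that obtain P where P: "A = poly P -` B"
      unfolding poly_reducible_def by blast
    have "\<not> degree P \<ge> 2"
      using split[of P] P by auto
    moreover have "degree P \<noteq> 0"
    proof
      assume "degree P = 0"
      then obtain c where "P = [:c:]"
        by (rule degree_eq_zeroE)
      (* Any polynomial of degree 2 exhibits both a point of A and a point outside A. *)
      moreover obtain x y where "x \<in> A" "y \<notin> A"
        using split[of "monom 1 2"] by (auto simp: degree_monom_eq)
      ultimately show False
        using P by auto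
    qed
    ultimately have "degree P = 1" by simp
    then obtain a b where "P = [:b, a:]" and "a \<noteq> 0"
      by (cases P rule: pCons_cases) (auto split: if_splits elim!: degree_eq_zeroE)
    then have "poly P (poly [:- b / a, 1 / a:] z) = z" for z
      by (simp add: field_simps)
    then have "B = poly [:- b / a, 1 / a:] -` A"
      unfolding P by auto
    then show ?thesis
      unfolding poly_reducible_def by blast
  qed
  then have "\<not> poly_degree_of A < poly_degree_of B" for B
    unfolding less_poly_degree_def by (auto simp: less_eq_poly_degree.abs_eq)
  then show ?thesis
    unfolding maximal_degree_def by (metis Quotient3_abs_rep Quotient3_poly_degree)
qed

text \<open>
  A member of the class of \<open>B\<close> is \<open>P\<^sup>-\<^sup>1(B)\<close> for some polynomial \<open>P\<close>, so each class is no larger than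
  the field. Therefore passing to classes cannot shrink a family that is larger than the field.
\<close>

lemma card_of_degrees_ordLeq:
  fixes F :: "'k::field set set"
  assumes inf: "infinite (UNIV :: 'k set)" and large: "|UNIV :: 'k set| <o |F|"
  shows "|F| \<le>o |poly_degree_of ` F|"
proof -
  let ?M = "poly_degree_of ` F"
  have "F \<subseteq> (\<lambda>(c, P). poly P -` rep_poly_degree c) ` (?M \<times> (UNIV :: 'k poly set))"
  proof
    fix A
    assume "A \<in> F"
    have "A \<equiv>\<^sub>p rep_poly_degree (poly_degree_of A)"
      by (metis Quotient3_poly_degree rep_abs_rsp equivp_poly_equivalent equivp_reflp)
    then obtain P where "A = poly P -` rep_poly_degree (poly_degree_of A)"
      unfolding poly_equivalent_def poly_reducible_def by blast
    with \<open>A \<in> F\<close> show "A \<in> (\<lambda>(c, P). poly P -` rep_poly_degree c) ` (?M \<times> UNIV)"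
      by (intro image_eqI[where x = "(poly_degree_of A, P)"]) auto
  qed
  then have "|F| \<le>o |?M \<times> (UNIV :: 'k poly set)|"
    by (rule surj_imp_ordLeq)
  also have "|?M \<times> (UNIV :: 'k poly set)| \<le>o |?M \<times> (UNIV :: 'k set)|"
    by (rule card_of_Times_mono2[OF card_of_poly_ordLeq[OF inf]])
  finally have bound: "|F| \<le>o |?M \<times> (UNIV :: 'k set)|" .
  have "\<not> |?M| \<le>o |UNIV :: 'k set|"
  proof
    assume "|?M| \<le>o |UNIV :: 'k set|"
    then have "|?M \<times> (UNIV :: 'k set)| \<le>o |(UNIV :: 'k set) \<times> (UNIV :: 'k set)|"
      by (rule card_of_Times_mono1)
    also have "|(UNIV :: 'k set) \<times> (UNIV :: 'k set)| =o |UNIV :: 'k set|"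
      by (rule card_of_Times_same_infinite[OF inf])
    finally have "|F| \<le>o |UNIV :: 'k set|"
      using bound ordLeq_transitive by blast
    with large show False
      using not_ordLess_ordLeq by blast
  qed
  then have le: "|UNIV :: 'k set| \<le>o |?M|"
    using ordLeq_total[OF card_of_Well_order card_of_Well_order] by metis
  then have "infinite ?M"
    using inf card_of_ordLeq_infinite by blast
  then have "|?M \<times> (UNIV :: 'k set)| =o |?M|"
    using card_of_Times_infinite[OF _ UNIV_not_empty le] by simp
  with bound show ?thesis
    by (rule ordLeq_ordIso_trans)
qed

theorem theorem48:
  shows "\<exists>M :: 'k::{alg_closed_field, field_char_0} poly_degree set.
    |M| =o ctwo ^c |UNIV :: 'k set| \<and>
    (\<forall>c\<in>M. c \<in> Sigma_inter_dual |UNIV :: 'k set| \<and> maximal_degree c)"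
proof -
  let ?K = "UNIV :: 'k set"
  have inf: "infinite ?K"
    by (rule infinite_UNIV_char_0)
  let ?D = "{P :: 'k poly. degree P \<ge> 2}"
  have "monom 1 2 \<in> ?D"
    by (simp add: degree_monom_eq)
  moreover have "|?D| \<le>o |?K|"
    using card_of_poly_ordLeq[OF inf] card_of_mono1[OF subset_UNIV] ordLeq_transitive by blast
  ultimately obtain p :: "'k \<Rightarrow> 'k poly" where p: "range p = ?D"
    using card_of_ordLeq2[of ?D ?K] by blast
  have "\<exists>x y. (\<forall>a. (x a, y a) \<in> {(u, v). poly (p a) u = poly (p a) v}) \<and>
      inj x \<and> inj y \<and> range x \<inter> range y = {}"
  proof (rule disjoint_pair_transversal[OF inf])
    fix a and X :: "'k set"
    assume "|X| <o |?K|"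
    moreover have "degree (p a) \<ge> 2"
      using p by auto
    ultimately show "\<exists>u v. (u, v) \<in> {(u, v). poly (p a) u = poly (p a) v} \<and> u \<noteq> v \<and> u \<notin> X \<and> v \<notin> X"
      using fibre_pair_avoiding[of "p a" X] by simp
  qed
  then obtain x y where fibre: "\<And>a. poly (p a) (x a) = poly (p a) (y a)"
    and inj: "inj x" "inj y" and disj: "range x \<inter> range y = {}"
    by auto
  have apart: "x a \<noteq> y b" for a b
    using disj by auto
  define A where "A S = x ` S \<union> y ` (- S)" for S
  have x_in: "x a \<in> A S \<longleftrightarrow> a \<in> S" and y_in: "y a \<in> A S \<longleftrightarrow> a \<notin> S" for a S
    by (auto simp: A_def inj_image_mem_iff[OF inj(1)] inj_image_mem_iff[OF inj(2)] apart
        apart[THEN not_sym])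
  have card_A: "|A S| =o |?K|" for S
  proof -
    let ?h = "\<lambda>a. if a \<in> S then x a else y a"
    have "inj ?h"
      by (rule injI) (simp split: if_splits
          add: inj_eq[OF inj(1)] inj_eq[OF inj(2)] apart apart[THEN not_sym])
    moreover have "range ?h \<subseteq> A S"
      by (auto simp: A_def)
    ultimately have "|?K| \<le>o |A S|"
      using card_of_ordLeq by blast
    then show ?thesis
      by (simp add: ordIso_iff_ordLeq card_of_mono1)
  qed
  (* Exchanging the roles of the two points in every pair gives a set disjoint from A S. *)
  have card_compl: "|- A S| =o |?K|" for S
  proof -
    have "A (- S) \<subseteq> - A S"
      using x_in y_in by (auto simp: A_def[of "- S"])
    then have "|?K| \<le>o |- A S|"
      by (metis card_A card_of_mono1 ordIso_ordLeq_trans ordIso_symmetric)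
    then show ?thesis
      by (simp add: ordIso_iff_ordLeq card_of_mono1)
  qed
  have max: "maximal_degree (poly_degree_of (A S))" for S
  proof (rule maximal_degreeI)
    fix P :: "'k poly"
    assume "degree P \<ge> 2"
    then obtain a where a: "P = p a"
      using p by blast
    show "\<exists>u\<in>A S. \<exists>v\<in>- A S. poly P u = poly P v"
    proof (cases "a \<in> S")
      case True
      then show ?thesis
        using fibre[of a] a by (intro bexI[of _ "x a"] bexI[of _ "y a"]) (simp_all add: x_in y_in)
    next
      case False
      then show ?thesis
        using fibre[of a] a by (intro bexI[of _ "y a"] bexI[of _ "x a"]) (simp_all add: x_in y_in)
    qed
  qed
  have "inj A"
    using x_in by (intro injI) blast
  then have card_range: "|range A| =o |Pow ?K|"
    by (metis Pow_UNIV bij_betw_imageI card_of_ordIsoI ordIso_symmetric)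
  let ?M = "poly_degree_of ` range A"
  have "|?K| <o |range A|"
    using card_of_Pow card_range ordIso_symmetric ordLess_ordIso_trans by blast
  then have "|range A| \<le>o |?M|"
    by (rule card_of_degrees_ordLeq[OF inf])
  then have "|?M| =o |range A|"
    by (simp add: ordIso_iff_ordLeq card_of_image)
  then have "|?M| =o ctwo ^c |?K|"
    unfolding cexp_def ctwo_def Field_card_of
    by (rule ordIso_transitive[OF ordIso_transitive[OF _ card_range] card_of_Pow_Func])
  moreover have "c \<in> Sigma_inter_dual |?K| \<and> maximal_degree c" if "c \<in> ?M" for c
    using that card_A card_compl max unfolding Sigma_inter_dual_def by blast
  ultimately show ?thesis
    by blast
qed

end
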